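(* Let $\kappa$ be a field and $K$ its algebraic closure. Let $(d):=(d_1,\ldots,d_n)$ be a degree list with $d_i\ge1$, and let $D:=d_1+\cdots+d_n-n$. Let $$\Delta_{(d)}:=\{\underline{\mu}=(\mu_1,\ldots,\mu_n)\in\mathbb{N}^n: 0\le\mu_i\le d_i-1\}$$ and $$\Omega_{(d)}:=\{f\in P_D^K(X_1,\ldots,X_n): \exists\,\underline{\mu}\in\Delta_{(d)},\ f_{\underline{\mu}}\ne0,\ |\underline{\mu}|=\deg(f)\}\cup\{0\}.$$ Then, for every finite sequence of subsets $E_1,\ldots,E_n\subseteq K$ with $\sharp(E_i)=d_i$, the Cartesian product $E:=E_1\times\cdots\times E_n$ is a correct test sequence for $\Omega_{(d)}$ with respect to $\Sigma=\{0\}$. Additionally, if $\sharp(\kappa)\ge\max\{d_i+1: 1\le i\le n\}$, one may choose $E_i\subseteq\kappa$ for every $i$, $1\le i\le n$.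
   Context: $P_D^K(X_1,\ldots,X_n)$ is the space of polynomials in $K[X_1,\ldots,X_n]$ of degree at most $D$. For $\underline{\mu}=(\mu_1,\ldots,\mu_n)\in\mathbb{N}^n$ (with $0\in\mathbb{N}$), $|\underline{\mu}|=\mu_1+\cdots+\mu_n$ and $f_{\underline{\mu}}$ is the coefficient of the monomial $X_1^{\mu_1}\cdots X_n^{\mu_n}$ in $f$. A finite set $E\subseteq K^n$ is a correct test sequence for a set of polynomials $\Omega$ with respect to $\{0\}$ if every $f\in\Omega$ vanishing at all points of $E$ is the zero polynomial. *)

theory Defs
  imports "HOL-Library.Poly_Mapping" "HOL-Library.FuncSet" "HOL-Algebra.Algebraic_Closure_Type"
begin

text \<open>Multi-indices are finitely supported exponent functions and polynomials are finitely
  supported coefficient functions on them, so the coefficient of \<open>f\<close> at \<open>\<mu>\<close> is \<open>lookup f \<mu>\<close>.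
  The variables \<open>X\<^sub>1, \<dots>, X\<^sub>n\<close> carry the indices \<open>{1..n}\<close>.\<close>

type_synonym multi_index = "nat \<Rightarrow>\<^sub>0 nat"
type_synonym 'k mpolynomial = "multi_index \<Rightarrow>\<^sub>0 'k"

definition multi_indices :: "nat \<Rightarrow> multi_index set" where
  "multi_indices n = {\<mu>. Poly_Mapping.keys \<mu> \<subseteq> {1..n}}"

definition weight :: "multi_index \<Rightarrow> nat" where
  "weight \<mu> = (\<Sum>i\<in>Poly_Mapping.keys \<mu>. Poly_Mapping.lookup \<mu> i)"

text \<open>The zero polynomial gets degree \<open>0\<close>, so it belongs to every \<open>polys_upto n D\<close> below.\<close>

definition total_degree :: "'k::zero mpolynomial \<Rightarrow> nat" where
  "total_degree f = Max (insert 0 (weight ` Poly_Mapping.keys f))"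

definition eval_poly :: "'k::comm_semiring_1 mpolynomial \<Rightarrow> (nat \<Rightarrow> 'k) \<Rightarrow> 'k" where
  "eval_poly f x =
     (\<Sum>\<mu>\<in>Poly_Mapping.keys f. Poly_Mapping.lookup f \<mu> *
        (\<Prod>i\<in>Poly_Mapping.keys \<mu>. x i ^ Poly_Mapping.lookup \<mu> i))"

definition polys_upto :: "nat \<Rightarrow> nat \<Rightarrow> 'k::zero mpolynomial set" where
  "polys_upto n D = {f. Poly_Mapping.keys f \<subseteq> multi_indices n \<and> total_degree f \<le> D}"

text \<open>Affine space \<open>K\<^sup>n\<close>, as functions that are \<open>undefined\<close> outside \<open>{1..n}\<close>.\<close>

definition affine_points :: "nat \<Rightarrow> (nat \<Rightarrow> 'k) set" where
  "affine_points n = (\<Pi>\<^sub>E i\<in>{1..n}. UNIV)"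

definition correct_test_sequence ::
    "nat \<Rightarrow> (nat \<Rightarrow> 'k::comm_semiring_1) set \<Rightarrow> 'k mpolynomial set \<Rightarrow> 'k mpolynomial set \<Rightarrow> bool" where
  "correct_test_sequence n E \<Omega> \<Sigma> \<longleftrightarrow>
     finite E \<and> E \<subseteq> affine_points n \<and>
     (\<forall>f\<in>\<Omega>. (\<forall>x\<in>E. eval_poly f x = 0) \<longrightarrow> f \<in> \<Sigma>)"

definition Delta :: "nat \<Rightarrow> (nat \<Rightarrow> nat) \<Rightarrow> multi_index set" where
  "Delta n d = {\<mu> \<in> multi_indices n. \<forall>i\<in>{1..n}. Poly_Mapping.lookup \<mu> i \<le> d i - 1}"

text \<open>The natural-number subtractions here and in \<open>Delta\<close> are exact when all \<open>d i \<ge> 1\<close>.\<close>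

definition Omega :: "nat \<Rightarrow> (nat \<Rightarrow> nat) \<Rightarrow> 'k::zero mpolynomial set" where
  "Omega n d =
     {f \<in> polys_upto n ((\<Sum>i=1..n. d i) - n).
        \<exists>\<mu>\<in>Delta n d. Poly_Mapping.lookup f \<mu> \<noteq> 0 \<and> weight \<mu> = total_degree f} \<union> {0}"

end

theory Submission
  imports Defs
begin

text \<open>The first claim is the non-vanishing form of Alon's Combinatorial Nullstellensatz, and it is
  proved here by exhibiting a linear functional.  On \<open>m + 1\<close> points of a field, the \<open>m\<close>-th
  divided difference is a weighted sum of point values that kills \<open>1, x, \<dots>, x\<^sup>m\<^sup>-\<^sup>1\<close>
  and sends \<open>x\<^sup>m\<close> to \<open>1\<close> (\<open>divided_difference_weights\<close>).  Let \<open>\<mu>\<close> be a multi-index of top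
  degree in the support of \<open>f\<close> with \<open>\<mu>\<^sub>i < d\<^sub>i\<close>.  Shrink each \<open>E\<^sub>i\<close> to a subset with
  \<open>\<mu>\<^sub>i + 1\<close> points and take the tensor product of the \<open>\<mu>\<^sub>i\<close>-th divided differences.  Every
  other multi-index \<open>\<nu>\<close> in the support has \<open>|\<nu>| \<le> |\<mu>|\<close> and hence \<open>\<nu>\<^sub>i < \<mu>\<^sub>i\<close> for some \<open>i\<close>, so its
  monomial is killed, and the functional takes the value \<open>f\<^sub>\<mu> \<noteq> 0\<close> on \<open>f\<close>.  Because this value is a
  combination of the values of \<open>f\<close> at points of \<open>E\<close>, they cannot all vanish
  (\<open>combinatorial_nullstellensatz\<close>).

  The second claim only asks for enough points in the base field, which embeds into its algebraic
  closure.\<close>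

text \<open>The weights are those of the divided difference, \<open>c a = 1 / (\<Prod>b \<in> A - {a}. a - b)\<close>,
  although the induction constructs them without this formula.  If \<open>c\<close> works for \<open>A\<close> and \<open>b\<close> is a
  new point, then dividing \<open>c a\<close> by \<open>a - b\<close> and giving \<open>b\<close> the weight that makes the total \<open>0\<close>
  yields moments \<open>S\<close> with \<open>S\<^bsub>j+1\<^esub> - b S\<^bsub>j\<^esub> = (\<Sum>a\<in>A. c a * a ^ j)\<close>.\<close>

lemma divided_difference_weights:
  fixes A :: "'k::field set"
  assumes "card A = Suc m"
  shows "\<exists>c. (\<forall>j<m. (\<Sum>a\<in>A. c a * a ^ j) = 0) \<and> (\<Sum>a\<in>A. c a * a ^ m) = 1"
  using assms
proof (induction m arbitrary: A)
  case 0
  then obtain a where "A = {a}"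
    by (auto simp: card_1_singleton_iff)
  then show ?case
    by (intro exI[of _ "\<lambda>_. 1"]) auto
next
  case (Suc m)
  then obtain b B where A: "A = insert b B" and b: "b \<notin> B" and B: "card B = Suc m"
    by (metis card_Suc_eq)
  have fin: "finite B"
    using B by (simp add: card_ge_0_finite)
  obtain c where c0: "\<And>j. j < m \<Longrightarrow> (\<Sum>a\<in>B. c a * a ^ j) = 0" and c1: "(\<Sum>a\<in>B. c a * a ^ m) = 1"
    using Suc.IH[OF B] by blast
  define w where "w a = (if a = b then - (\<Sum>x\<in>B. c x / (x - b)) else c a / (a - b))" for a
  define S where "S j = (\<Sum>a\<in>A. w a * a ^ j)" for j
  have wB: "(\<Sum>x\<in>B. w x * g x) = (\<Sum>x\<in>B. c x / (x - b) * g x)" for g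
    using b by (intro sum.cong) (auto simp: w_def)
  have S0: "S 0 = 0"
    using wB[of "\<lambda>_. 1"] b fin by (simp add: S_def A w_def)
  have rec: "S (Suc j) - b * S j = (\<Sum>a\<in>B. c a * a ^ j)" for j
  proof -
    have "S (Suc j) - b * S j = (\<Sum>a\<in>A. w a * ((a - b) * a ^ j))"
      by (simp add: S_def sum_distrib_left sum_subtractf algebra_simps)
    also have "\<dots> = (\<Sum>a\<in>B. w a * ((a - b) * a ^ j))"
      using b fin by (simp add: A)
    also have "\<dots> = (\<Sum>a\<in>B. c a / (a - b) * ((a - b) * a ^ j))"
      by (rule wB)
    also have "\<dots> = (\<Sum>a\<in>B. c a * a ^ j)"
      using b by (intro sum.cong) auto
    finally show ?thesis .
  qed
  have low: "S j = 0" if "j \<le> m" for j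
    using that
  proof (induction j)
    case 0
    then show ?case by (simp add: S0)
  next
    case (Suc j)
    then show ?case using rec[of j] c0[of j] by simp
  qed
  have "S (Suc m) = 1"
    using rec[of m] c1 low[of m] by simp
  then show ?case
    using low unfolding S_def by (intro exI[of _ w]) (auto simp: less_Suc_eq_le)
qed

lemma weight_eq_sum:
  assumes "\<mu> \<in> multi_indices n"
  shows "weight \<mu> = (\<Sum>i\<in>{1..n}. Poly_Mapping.lookup \<mu> i)"
  unfolding weight_def using assms
  by (intro sum.mono_neutral_left) (auto simp: multi_indices_def in_keys_iff)

lemma monomial_eq_prod:
  fixes x :: "nat \<Rightarrow> 'k::comm_semiring_1"
  assumes "\<mu> \<in> multi_indices n"
  shows "(\<Prod>i\<in>Poly_Mapping.keys \<mu>. x i ^ Poly_Mapping.lookup \<mu> i)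
       = (\<Prod>i\<in>{1..n}. x i ^ Poly_Mapping.lookup \<mu> i)"
  using assms
  by (intro prod.mono_neutral_left) (auto simp: multi_indices_def in_keys_iff)

lemma multi_index_exceeds_somewhere:
  assumes "\<mu> \<in> multi_indices n" "\<nu> \<in> multi_indices n" "weight \<nu> \<le> weight \<mu>" "\<nu> \<noteq> \<mu>"
  obtains i where "i \<in> {1..n}" "Poly_Mapping.lookup \<nu> i < Poly_Mapping.lookup \<mu> i"
proof (rule ccontr)
  assume "\<not> thesis"
  with that have ge: "Poly_Mapping.lookup \<mu> i \<le> Poly_Mapping.lookup \<nu> i" if "i \<in> {1..n}" for i
    using \<open>i \<in> {1..n}\<close> not_less by blast
  have "(\<Sum>i\<in>{1..n}. Poly_Mapping.lookup \<mu> i) = (\<Sum>i\<in>{1..n}. Poly_Mapping.lookup \<nu> i)"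
    using assms(3) sum_mono[of "{1..n}", OF ge]
    unfolding weight_eq_sum[OF assms(1)] weight_eq_sum[OF assms(2)] by (rule antisym[rotated])
  then have "Poly_Mapping.lookup \<mu> i = Poly_Mapping.lookup \<nu> i" if "i \<in> {1..n}" for i
    using sum_mono_inv[OF _ ge that] by simp
  moreover have "Poly_Mapping.lookup \<mu> i = 0 \<and> Poly_Mapping.lookup \<nu> i = 0" if "i \<notin> {1..n}" for i
    using assms(1,2) that by (auto simp: multi_indices_def in_keys_iff)
  ultimately have "\<nu> = \<mu>"
    by (intro poly_mapping_eqI) metis
  with assms(4) show False by simp
qed

text \<open>A product of univariate functionals factors over monomials, which reduces its value on a
  polynomial to univariate moments.\<close>

lemma tensor_functional_eval_poly:
  fixes f :: "'k::comm_semiring_1 mpolynomial"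
  assumes "Poly_Mapping.keys f \<subseteq> multi_indices n" "\<And>i. i \<in> {1..n} \<Longrightarrow> finite (A i)"
  shows "(\<Sum>x\<in>(\<Pi>\<^sub>E i\<in>{1..n}. A i). (\<Prod>i\<in>{1..n}. c i (x i)) * eval_poly f x)
       = (\<Sum>\<nu>\<in>Poly_Mapping.keys f. Poly_Mapping.lookup f \<nu> *
            (\<Prod>i\<in>{1..n}. \<Sum>a\<in>A i. c i a * a ^ Poly_Mapping.lookup \<nu> i))"
proof -
  have "(\<Sum>x\<in>(\<Pi>\<^sub>E i\<in>{1..n}. A i). (\<Prod>i\<in>{1..n}. c i (x i)) * eval_poly f x)
      = (\<Sum>x\<in>(\<Pi>\<^sub>E i\<in>{1..n}. A i). \<Sum>\<nu>\<in>Poly_Mapping.keys f. Poly_Mapping.lookup f \<nu> *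
           (\<Prod>i\<in>{1..n}. c i (x i) * x i ^ Poly_Mapping.lookup \<nu> i))"
    unfolding eval_poly_def sum_distrib_left
  proof (intro sum.cong refl)
    fix x \<nu>
    assume "\<nu> \<in> Poly_Mapping.keys f"
    then have "\<nu> \<in> multi_indices n" using assms(1) by blast
    then show "(\<Prod>i\<in>{1..n}. c i (x i)) * (Poly_Mapping.lookup f \<nu> *
            (\<Prod>i\<in>Poly_Mapping.keys \<nu>. x i ^ Poly_Mapping.lookup \<nu> i))
        = Poly_Mapping.lookup f \<nu> * (\<Prod>i\<in>{1..n}. c i (x i) * x i ^ Poly_Mapping.lookup \<nu> i)"
      by (simp only: monomial_eq_prod prod.distrib mult_ac)
  qed
  also have "\<dots> = (\<Sum>\<nu>\<in>Poly_Mapping.keys f. Poly_Mapping.lookup f \<nu> *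
           (\<Sum>x\<in>(\<Pi>\<^sub>E i\<in>{1..n}. A i). \<Prod>i\<in>{1..n}. c i (x i) * x i ^ Poly_Mapping.lookup \<nu> i))"
    by (subst sum.swap) (simp add: sum_distrib_left)
  also have "\<dots> = (\<Sum>\<nu>\<in>Poly_Mapping.keys f. Poly_Mapping.lookup f \<nu> *
            (\<Prod>i\<in>{1..n}. \<Sum>a\<in>A i. c i a * a ^ Poly_Mapping.lookup \<nu> i))"
    using assms(2) by (subst prod_sum_PiE) auto
  finally show ?thesis .
qed

lemma combinatorial_nullstellensatz:
  fixes f :: "'k::field mpolynomial"
  assumes f: "Poly_Mapping.keys f \<subseteq> multi_indices n"
    and \<mu>: "Poly_Mapping.lookup f \<mu> \<noteq> 0" "weight \<mu> = total_degree f"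
    and E: "\<And>i. i \<in> {1..n} \<Longrightarrow> Poly_Mapping.lookup \<mu> i < card (E i)"
  obtains x where "x \<in> (\<Pi>\<^sub>E i\<in>{1..n}. E i)" "eval_poly f x \<noteq> 0"
proof -
  have \<mu>f: "\<mu> \<in> Poly_Mapping.keys f" and \<mu>n: "\<mu> \<in> multi_indices n"
    using f \<mu>(1) by (auto simp: in_keys_iff)
  have "\<forall>i\<in>{1..n}. \<exists>B. B \<subseteq> E i \<and> card B = Suc (Poly_Mapping.lookup \<mu> i)"
    using E obtain_subset_with_card_n by (metis Suc_leI)
  then obtain A where A: "\<And>i. i \<in> {1..n} \<Longrightarrow> A i \<subseteq> E i"
      "\<And>i. i \<in> {1..n} \<Longrightarrow> card (A i) = Suc (Poly_Mapping.lookup \<mu> i)"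
    by metis
  have finA: "finite (A i)" if "i \<in> {1..n}" for i
    using A(2)[OF that] by (simp add: card_ge_0_finite)
  have "\<forall>i\<in>{1..n}. \<exists>c. (\<forall>j<Poly_Mapping.lookup \<mu> i. (\<Sum>a\<in>A i. c a * a ^ j) = 0)
                       \<and> (\<Sum>a\<in>A i. c a * a ^ Poly_Mapping.lookup \<mu> i) = 1"
    using divided_difference_weights A(2) by blast
  then obtain c where
      c0: "\<And>i j. i \<in> {1..n} \<Longrightarrow> j < Poly_Mapping.lookup \<mu> i \<Longrightarrow> (\<Sum>a\<in>A i. c i a * a ^ j) = 0"
      and c1: "\<And>i. i \<in> {1..n} \<Longrightarrow> (\<Sum>a\<in>A i. c i a * a ^ Poly_Mapping.lookup \<mu> i) = 1"
    by metis
  define M where "M \<nu> = (\<Prod>i\<in>{1..n}. \<Sum>a\<in>A i. c i a * a ^ Poly_Mapping.lookup \<nu> i)" for \<nu>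
  have M\<mu>: "M \<mu> = 1"
    unfolding M_def using c1 by (intro prod.neutral) blast
  have M0: "M \<nu> = 0" if "\<nu> \<in> Poly_Mapping.keys f" "\<nu> \<noteq> \<mu>" for \<nu>
  proof -
    have le: "weight \<nu> \<le> weight \<mu>"
      unfolding \<mu>(2) total_degree_def using that(1) by (intro Max_ge) auto
    have "\<nu> \<in> multi_indices n"
      using f that(1) by blast
    from multi_index_exceeds_somewhere[OF \<mu>n this le that(2)]
    obtain i where "i \<in> {1..n}" "Poly_Mapping.lookup \<nu> i < Poly_Mapping.lookup \<mu> i" .
    then show ?thesis
      unfolding M_def using c0 by (intro prod_zero bexI[of _ i]) simp_all
  qed
  have "(\<Sum>x\<in>(\<Pi>\<^sub>E i\<in>{1..n}. A i). (\<Prod>i\<in>{1..n}. c i (x i)) * eval_poly f x)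
      = (\<Sum>\<nu>\<in>Poly_Mapping.keys f. Poly_Mapping.lookup f \<nu> * M \<nu>)"
    unfolding M_def using f finA by (rule tensor_functional_eval_poly)
  also have "\<dots> = (\<Sum>\<nu>\<in>Poly_Mapping.keys f. if \<nu> = \<mu> then Poly_Mapping.lookup f \<mu> else 0)"
    by (intro sum.cong) (auto simp: M\<mu> M0)
  also have "\<dots> = Poly_Mapping.lookup f \<mu>"
    using \<mu>f by simp
  finally have "\<exists>x\<in>(\<Pi>\<^sub>E i\<in>{1..n}. A i). eval_poly f x \<noteq> 0"
    using \<mu>(1) sum.neutral[of "\<Pi>\<^sub>E i\<in>{1..n}. A i"
        "\<lambda>x. (\<Prod>i\<in>{1..n}. c i (x i)) * eval_poly f x"] by auto
  moreover have "(\<Pi>\<^sub>E i\<in>{1..n}. A i) \<subseteq> (\<Pi>\<^sub>E i\<in>{1..n}. E i)"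
    using A(1) by (rule PiE_mono)
  ultimately show thesis
    using that by blast
qed

lemma correct_test_sequence_grid:
  fixes E :: "nat \<Rightarrow> 'k::field set"
  assumes d: "\<And>i. i \<in> {1..n} \<Longrightarrow> d i \<ge> 1" and E: "\<And>i. i \<in> {1..n} \<Longrightarrow> card (E i) = d i"
  shows "correct_test_sequence n (\<Pi>\<^sub>E i\<in>{1..n}. E i) (Omega n d) {0}"
  unfolding correct_test_sequence_def
proof (intro conjI ballI impI)
  have "finite (E i)" if "i \<in> {1..n}" for i
    using d[OF that] E[OF that] by (intro card_ge_0_finite) simp
  then show "finite (\<Pi>\<^sub>E i\<in>{1..n}. E i)"
    by (intro finite_PiE) auto
  show "(\<Pi>\<^sub>E i\<in>{1..n}. E i) \<subseteq> affine_points n"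
    unfolding affine_points_def by (intro PiE_mono) auto
next
  fix f :: "'k mpolynomial"
  assume f: "f \<in> Omega n d" and van: "\<forall>x\<in>(\<Pi>\<^sub>E i\<in>{1..n}. E i). eval_poly f x = 0"
  show "f \<in> {0}"
  proof (rule ccontr)
    assume "f \<notin> {0}"
    with f obtain \<mu> where \<mu>: "\<mu> \<in> Delta n d" "Poly_Mapping.lookup f \<mu> \<noteq> 0" "weight \<mu> = total_degree f"
      and keys: "Poly_Mapping.keys f \<subseteq> multi_indices n"
      unfolding Omega_def polys_upto_def by blast
    have "Poly_Mapping.lookup \<mu> i < card (E i)" if "i \<in> {1..n}" for i
      using \<mu>(1) d[OF that] E[OF that] that unfolding Delta_def by fastforce
    from combinatorial_nullstellensatz[OF keys \<mu>(2,3) this] van show False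
      by blast
  qed
qed

lemma subset_of_range_with_card:
  assumes "inj g" "infinite (UNIV :: 'a set) \<or> m \<le> card (UNIV :: 'a set)"
  shows "\<exists>B. card B = m \<and> B \<subseteq> range (g :: 'a \<Rightarrow> 'b)"
proof -
  obtain C :: "'a set" where "card C = m"
    using assms(2) infinite_arbitrarily_large obtain_subset_with_card_n by metis
  then have "card (g ` C) = m"
    using assms(1) by (metis card_image inj_on_subset subset_UNIV)
  then show ?thesis by blast
qed

theorem theoremB5:
  fixes n :: nat and d :: "nat \<Rightarrow> nat"
  assumes "\<forall>i\<in>{1..n}. d i \<ge> 1"
  shows "(\<forall>E :: nat \<Rightarrow> 'a::field alg_closure set.
            (\<forall>i\<in>{1..n}. card (E i) = d i) \<longrightarrow>
            correct_test_sequence n (\<Pi>\<^sub>E i\<in>{1..n}. E i) (Omega n d) {0})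
       \<and> (infinite (UNIV :: 'a set) \<or> card (UNIV :: 'a set) \<ge> Max {d i + 1 | i. 1 \<le> i \<and> i \<le> n} \<longrightarrow>
            (\<exists>E :: nat \<Rightarrow> 'a alg_closure set.
               (\<forall>i\<in>{1..n}. card (E i) = d i \<and> E i \<subseteq> range to_ac) \<and>
               correct_test_sequence n (\<Pi>\<^sub>E i\<in>{1..n}. E i) (Omega n d) {0}))"
proof (intro conjI allI impI)
  fix E :: "nat \<Rightarrow> 'a alg_closure set"
  assume "\<forall>i\<in>{1..n}. card (E i) = d i"
  then show "correct_test_sequence n (\<Pi>\<^sub>E i\<in>{1..n}. E i) (Omega n d) {0}"
    using assms by (intro correct_test_sequence_grid) auto
next
  assume large: "infinite (UNIV :: 'a set) \<or>
    card (UNIV :: 'a set) \<ge> Max {d i + 1 | i. 1 \<le> i \<and> i \<le> n}"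
  have "infinite (UNIV :: 'a set) \<or> d i \<le> card (UNIV :: 'a set)" if "i \<in> {1..n}" for i
  proof -
    have "{d i + 1 | i. 1 \<le> i \<and> i \<le> n} = (\<lambda>i. d i + 1) ` {1..n}" by auto
    then have "d i + 1 \<le> Max {d i + 1 | i. 1 \<le> i \<and> i \<le> n}"
      using that by simp
    then show ?thesis using large by linarith
  qed
  then have "\<forall>i\<in>{1..n}. \<exists>B. card B = d i \<and> B \<subseteq> range (to_ac :: 'a \<Rightarrow> 'a alg_closure)"
    by (blast intro: subset_of_range_with_card[OF inj_to_ac])
  then obtain E :: "nat \<Rightarrow> 'a alg_closure set"
    where E: "\<forall>i\<in>{1..n}. card (E i) = d i \<and> E i \<subseteq> range to_ac"
    by metis
  then have "correct_test_sequence n (\<Pi>\<^sub>E i\<in>{1..n}. E i) (Omega n d) {0}"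
    using assms by (intro correct_test_sequence_grid) auto
  with E show "\<exists>E :: nat \<Rightarrow> 'a alg_closure set.
      (\<forall>i\<in>{1..n}. card (E i) = d i \<and> E i \<subseteq> range to_ac) \<and>
      correct_test_sequence n (\<Pi>\<^sub>E i\<in>{1..n}. E i) (Omega n d) {0}"
    by blast
qed

end
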